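(* Let $G=(V,E)$ be a graph and $\mathbf k,\mathbf u\in\mathbb{Z}_+^V$. Let $\mathbf k'\in\mathbb{Z}^V$ be defined by $k'(v)=u(N[v])-k(v)$ for each $v\in V$. Then $$L_{\mathbf k,\mathbf u}(G)=u(V)-\gamma_{\mathbf k',\mathbf u}(G)\quad\text{and}\quad \gamma_{\mathbf k,\mathbf u}(G)=u(V)-L_{\mathbf k',\mathbf u}(G).$$
   Context: Graphs are finite, simple, undirected; $N[v]$ is the closed neighborhood of $v$; for $h:V\to\mathbb{Z}$ and $U\subseteq V$, $h(U)=\sum_{x\in U}h(x)$. For integer vectors $\mathbf k,\mathbf u$ indexed by $V$ (with $\mathbf u\geq 0$), a function $f:V\to\mathbb{Z}_+$ is a $(\mathbf k,\mathbf u)$-dominating function (resp. $(\mathbf k,\mathbf u)$-packing function) of $G$ if $f(v)\leq u(v)$ and $f(N[v])\geq k(v)$ (resp. $f(N[v])\leq k(v)$) for all $v\in V$. $\gamma_{\mathbf k,\mathbf u}(G)$ is the minimum of $f(V)$ over all $(\mathbf k,\mathbf u)$-dominating functions, and $L_{\mathbf k,\mathbf u}(G)$ is the maximum of $f(V)$ over all $(\mathbf k,\mathbf u)$-packing functions, with conventions $\min\emptyset=+\infty$ and $\max\emptyset=-\infty$. (GDF is the problem of computing $\gamma_{\mathbf k,\mathbf u}(G)$, GPF that of computing $L_{\mathbf k,\mathbf u}(G)$.) *)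

theory Defs
  imports "HOL-Library.Extended_Real" "Graph_Theory.Digraph"
begin

definition closed_nbhd :: "('a, 'b) pre_digraph \<Rightarrow> 'a \<Rightarrow> 'a set" where
  "closed_nbhd G v = insert v {w. v \<rightarrow>\<^bsub>G\<^esub> w}"

text \<open>
  Functions on the vertex set are total functions whose values outside \<^term>\<open>verts G\<close> are
  unconstrained; they never enter the sums below when \<^term>\<open>G\<close> is a graph.
\<close>

definition dominating_function ::
  "('a, 'b) pre_digraph \<Rightarrow> ('a \<Rightarrow> int) \<Rightarrow> ('a \<Rightarrow> int) \<Rightarrow> ('a \<Rightarrow> int) \<Rightarrow> bool" where
  "dominating_function G k u f \<longleftrightarrow>
     (\<forall>v\<in>verts G. 0 \<le> f v \<and> f v \<le> u v \<and> k v \<le> sum f (closed_nbhd G v))"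

definition packing_function ::
  "('a, 'b) pre_digraph \<Rightarrow> ('a \<Rightarrow> int) \<Rightarrow> ('a \<Rightarrow> int) \<Rightarrow> ('a \<Rightarrow> int) \<Rightarrow> bool" where
  "packing_function G k u f \<longleftrightarrow>
     (\<forall>v\<in>verts G. 0 \<le> f v \<and> f v \<le> u v \<and> sum f (closed_nbhd G v) \<le> k v)"

definition dom_number ::
  "('a, 'b) pre_digraph \<Rightarrow> ('a \<Rightarrow> int) \<Rightarrow> ('a \<Rightarrow> int) \<Rightarrow> ereal" where
  "dom_number G k u =
     (if \<exists>f. dominating_function G k u f
      then ereal (of_int (Min {sum f (verts G) | f. dominating_function G k u f}))
      else \<infinity>)"

definition packing_number ::
  "('a, 'b) pre_digraph \<Rightarrow> ('a \<Rightarrow> int) \<Rightarrow> ('a \<Rightarrow> int) \<Rightarrow> ereal" where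
  "packing_number G k u =
     (if \<exists>f. packing_function G k u f
      then ereal (of_int (Max {sum f (verts G) | f. packing_function G k u f}))
      else - \<infinity>)"

text \<open>
  The sets of values are finite, so \<^const>\<open>Min\<close> and \<^const>\<open>Max\<close> above are genuine extrema.
\<close>

lemma finite_dominating_values: "finite {sum f (verts G) | f. dominating_function G k u f}"
  by (rule finite_subset[of _ "{0..sum u (verts G)}"])
    (auto simp: dominating_function_def intro!: sum_nonneg sum_mono)

lemma finite_packing_values: "finite {sum f (verts G) | f. packing_function G k u f}"
  by (rule finite_subset[of _ "{0..sum u (verts G)}"])
    (auto simp: packing_function_def intro!: sum_nonneg sum_mono)

end

theory Submission
  imports Defs
begin

text \<open>
  The involution \<open>f \<mapsto> u - f\<close> exchanges packing functions for \<open>k\<close> with dominating functions for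
  \<open>k'\<close> and sends total weight \<open>x\<close> to \<open>u(V) - x\<close>. The relation between \<open>k\<close> and \<open>k'\<close> is symmetric,
  so the second identity is the first one with \<open>k\<close> and \<open>k'\<close> exchanged, solved for \<open>\<gamma>\<close>.
\<close>

text \<open>Complementing in \<open>u\<close> preserves the bounds
  \<open>0 \<le> f v \<le> u v\<close> and turns a neighborhood sum \<open>s\<close> into
  \<open>sum u (closed_nbhd G v) - s\<close>, so an upper bound \<open>k v\<close> becomes the lower
  bound \<open>k' v\<close>.\<close>

lemma dominating_function_complement_iff:
  assumes "\<forall>v\<in>verts G. k' v = sum u (closed_nbhd G v) - k v"
  shows "dominating_function G k' u (\<lambda>v. u v - f v) \<longleftrightarrow> packing_function G k u f"
  using assms unfolding dominating_function_def packing_function_def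
  by (auto simp: sum_subtractf)

lemma packing_function_complement_iff:
  assumes "\<forall>v\<in>verts G. k' v = sum u (closed_nbhd G v) - k v"
  shows "packing_function G k u (\<lambda>v. u v - f v) \<longleftrightarrow> dominating_function G k' u f"
  using dominating_function_complement_iff[OF assms, of "\<lambda>v. u v - f v"] by simp

text \<open>The complement of the given function is the witness in both inclusions. Having equality
  of the value sets lets the extrema be compared directly.\<close>

lemma packing_values_eq:
  assumes "\<forall>v\<in>verts G. k' v = sum u (closed_nbhd G v) - k v"
  shows "{sum f (verts G) | f. packing_function G k u f} =
    (\<lambda>x. sum u (verts G) - x) ` {sum f (verts G) | f. dominating_function G k' u f}"
    (is "?P = ?c ` ?D")
proof
  show "?P \<subseteq> ?c ` ?D"
  proof
    fix x assume "x \<in> ?P"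
    then obtain f where f: "packing_function G k u f" and x: "x = sum f (verts G)" by blast
    from f have "dominating_function G k' u (\<lambda>v. u v - f v)"
      by (simp add: dominating_function_complement_iff[OF assms])
    then have "sum (\<lambda>v. u v - f v) (verts G) \<in> ?D" by blast
    moreover have "x = ?c (sum (\<lambda>v. u v - f v) (verts G))" by (simp add: x sum_subtractf)
    ultimately show "x \<in> ?c ` ?D" by (rule rev_image_eqI)
  qed
next
  show "?c ` ?D \<subseteq> ?P"
  proof (rule image_subsetI)
    fix x assume "x \<in> ?D"
    then obtain f where f: "dominating_function G k' u f" and x: "x = sum f (verts G)" by blast
    from f have "packing_function G k u (\<lambda>v. u v - f v)"
      by (simp add: packing_function_complement_iff[OF assms])
    moreover have "?c x = sum (\<lambda>v. u v - f v) (verts G)" by (simp add: x sum_subtractf)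
    ultimately show "?c x \<in> ?P" by blast
  qed
qed

lemma Max_diff_image_eq:
  fixes A :: "'a :: linordered_ab_group_add set"
  assumes "finite A" "A \<noteq> {}"
  shows "Max ((\<lambda>x. c - x) ` A) = c - Min A"
  using assms by (intro Max_eqI) (auto intro!: imageI Min_in)

lemma packing_number_eq:
  assumes "\<forall>v\<in>verts G. k' v = sum u (closed_nbhd G v) - k v"
  shows "packing_number G k u = ereal (of_int (sum u (verts G))) - dom_number G k' u"
proof (cases "\<exists>f. dominating_function G k' u f")
  case True
  then have "\<exists>f. packing_function G k u f"
    using packing_function_complement_iff[OF assms] by blast
  moreover have "Max {sum f (verts G) | f. packing_function G k u f} =
      sum u (verts G) - Min {sum f (verts G) | f. dominating_function G k' u f}"
    unfolding packing_values_eq[OF assms]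
    using True by (intro Max_diff_image_eq finite_dominating_values) blast
  ultimately show ?thesis
    using True by (simp add: packing_number_def dom_number_def)
next
  case False
  then have "\<not> (\<exists>f. packing_function G k u f)"
    using dominating_function_complement_iff[OF assms] by blast
  \<comment> \<open>Both sides are \<open>-\<infinity>\<close>: the empty minimum is
    \<open>\<infinity>\<close>, and a finite number minus \<open>\<infinity>\<close> is
    \<open>-\<infinity>\<close>.\<close>
  with False show ?thesis
    by (simp add: packing_number_def dom_number_def)
qed

theorem theorem1:
  fixes G :: "('a, 'b) pre_digraph" and k u k' :: "'a \<Rightarrow> int"
  assumes "graph G"
    and "\<forall>v\<in>verts G. 0 \<le> k v"
    and "\<forall>v\<in>verts G. 0 \<le> u v"
    and "\<forall>v\<in>verts G. k' v = sum u (closed_nbhd G v) - k v"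
  shows "packing_number G k u = ereal (of_int (sum u (verts G))) - dom_number G k' u \<and>
         dom_number G k u = ereal (of_int (sum u (verts G))) - packing_number G k' u"
proof
  show "packing_number G k u = ereal (of_int (sum u (verts G))) - dom_number G k' u"
    using assms(4) by (rule packing_number_eq)
  have "packing_number G k' u = ereal (of_int (sum u (verts G))) - dom_number G k u"
    using assms(4) by (intro packing_number_eq) simp
  then show "dom_number G k u = ereal (of_int (sum u (verts G))) - packing_number G k' u"
    \<comment> \<open>Extended reals do not cancel in general, but subtracting from a finite number
      is an involution, also at \<open>\<infinity>\<close> and \<open>-\<infinity>\<close>; the case
      split checks this.\<close>
    by (cases "dom_number G k u") simp_all
qed

end
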